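(* Let $A,B,C,D\in\mathbb{C}$ and let $E$ be a negative integer. Then $$ {}_{9}F_{8}\left(\begin{matrix} A,\;1+A/2,\;B,\;\Delta(C,2),\;\Delta(D,2),\;\Delta(E,2) \\ A/2,\;1+A-B,\;\Delta(1+2A-C,2),\;\Delta(1+2A-D,2),\;\Delta(1+2A-E,2) \end{matrix}\right) $$ $$ =\frac{\Gamma(1+2A-C)\Gamma(1+2A-D)\Gamma(1+2A-E)\Gamma(1+2A-C-D-E)}{\Gamma(1+2A)\Gamma(1+2A-C-D)\Gamma(1+2A-C-E)\Gamma(1+2A-D-E)}\; {}_{4}F_{3}\left(\begin{matrix} A-B+1/2,\;C,\;D,\;E \\ A+1/2,\;2A-2B+1,\;C+D+E-2A \end{matrix}\right). $$ The formula also remains true for $E\in\mathbb{C}$ if the series on the left-hand side converges while the series on the right-hand side terminates.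
   Context: ${}_pF_q$ denotes the generalized hypergeometric series evaluated at unit argument; $\Delta(a,2)=(a/2,(a+1)/2)$. A series terminates if one of its upper parameters is a non-positive integer. Standing convention: lower parameters are never non-positive integers, and the Gamma functions occurring are not evaluated at poles. *)

theory Defs
  imports "HOL-Analysis.Analysis" "HOL-Computational_Algebra.Formal_Power_Series"
begin

(* The library's generalized hypergeometric power series with argument scaled by 1,
   so its n-th coefficient is the n-th term of the series at unit argument. *)
definition hyp_terms :: "complex list \<Rightarrow> complex list \<Rightarrow> nat \<Rightarrow> complex" where
  "hyp_terms as bs = fps_nth (fps_hypergeo as bs 1)"

(* Meaningful only under hyp_converges (suminf is otherwise unspecified). *)
definition hyp_at_1 :: "complex list \<Rightarrow> complex list \<Rightarrow> complex" where
  "hyp_at_1 as bs = (\<Sum>n. hyp_terms as bs n)"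

definition hyp_converges :: "complex list \<Rightarrow> complex list \<Rightarrow> bool" where
  "hyp_converges as bs \<longleftrightarrow> summable (hyp_terms as bs)"

definition hyp_terminates :: "complex list \<Rightarrow> bool" where
  "hyp_terminates as \<longleftrightarrow> (\<exists>a\<in>set as. a \<in> \<int>\<^sub>\<le>\<^sub>0)"

definition hyp_lower_ok :: "complex list \<Rightarrow> bool" where
  "hyp_lower_ok bs \<longleftrightarrow> (\<forall>b\<in>set bs. b \<notin> \<int>\<^sub>\<le>\<^sub>0)"

definition Delta2 :: "complex \<Rightarrow> complex list" where
  "Delta2 a = [a / 2, (a + 1) / 2]"

end

theory Submission
  imports Defs
begin

(* By symmetry in C, D, E one may take E = -n: if A - B + 1/2 is a non-positive integer, then so is the
   lower parameter 2A - 2B + 1, which is excluded. The factors of the left-hand series containing C, D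
   and E are expanded by the Pfaff-Saalschuetz sum into a combination of the kernels
   1 / ((j - m)! (1 + 2A)_(j + m)), with m = 2k (Bailey's lemma). After exchanging the sums, the
   inner sum over k is a terminating very-well-poised 5F4 with parameters A, B, -j/2, (1 - j)/2,
   and its closed form is found by a WZ recursion in j. *)

section \<open>The Pfaff-Saalschuetz sum\<close>

text \<open>This is Zeilberger's recursion from \<open>N = K + M\<close> to \<open>Suc N\<close>,
  summed over an initial segment: the right-hand side is the telescoping certificate. Writing
  \<open>N\<close> as \<open>K + M\<close> avoids truncated subtraction. At \<open>M = 0\<close> the
  right-hand side is minus the summand \<open>k = Suc N\<close> that the sum for
  \<open>Suc N\<close> still lacks.\<close>

lemma pfaff_saalschuetz_telescope:
  fixes x y c :: "'a::field_char_0"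
  shows "(\<Sum>k\<le>K. of_nat (Suc (K + M) choose k) * pochhammer x k * pochhammer y k
              * pochhammer (c + of_nat k) (Suc (K + M) - k) * pochhammer (c - x - y) (Suc (K + M) - k)
            - (c - x + of_nat (K + M)) * (c - y + of_nat (K + M)) *
              (of_nat ((K + M) choose k) * pochhammer x k * pochhammer y k
              * pochhammer (c + of_nat k) (K + M - k) * pochhammer (c - x - y) (K + M - k)))
         = - of_nat ((K + M) choose K) * pochhammer x (Suc K) * pochhammer y (Suc K)
              * pochhammer (c + of_nat K) M * pochhammer (c - x - y) M"
proof (induction K arbitrary: M)
  case 0
  show ?case by (simp add: pochhammer_Suc algebra_simps)
next
  case (Suc K)
  define N where "N = Suc (K + M)"
  define X where "X = pochhammer x (Suc K)"
  define Y where "Y = pochhammer y (Suc K)"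
  define p where "p = pochhammer (c + of_nat (Suc K)) M"
  define q where "q = pochhammer (c - x - y) M"
  define b where "b = (of_nat (N choose K) :: 'a)"
  have "Suc K * (N choose Suc K) = (N - K) * (N choose K)"
    by (metis binomial_absorb_comp binomial_absorption mult.commute)
  hence "of_nat (Suc K) * (of_nat (N choose Suc K) :: 'a) = of_nat (Suc M) * b"
    unfolding b_def N_def by (metis Suc_diff_le add_diff_cancel_left' le_add1 of_nat_mult)
  hence b': "of_nat (N choose Suc K) = of_nat (Suc M) * b / of_nat (Suc K)"
    by (metis nonzero_mult_div_cancel_left of_nat_neq_0)
  have bS: "of_nat (Suc N choose Suc K) = b + of_nat (Suc M) * b / of_nat (Suc K)"
    by (simp add: b_def[symmetric] b' del: of_nat_Suc)
  have pK: "pochhammer (c + of_nat K) (Suc M) = (c + of_nat K) * p"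
    by (simp add: p_def pochhammer_rec[of "c + of_nat K"] ac_simps)
  have qS: "pochhammer (c - x - y) (Suc M) = q * (c - x - y + of_nat M)"
    by (simp add: q_def pochhammer_Suc)
  have IH: "(\<Sum>k\<le>K. of_nat (Suc N choose k) * pochhammer x k * pochhammer y k
              * pochhammer (c + of_nat k) (Suc N - k) * pochhammer (c - x - y) (Suc N - k)
            - (c - x + of_nat N) * (c - y + of_nat N) *
              (of_nat (N choose k) * pochhammer x k * pochhammer y k
              * pochhammer (c + of_nat k) (N - k) * pochhammer (c - x - y) (N - k)))
         = - b * X * Y * ((c + of_nat K) * p) * (q * (c - x - y + of_nat M))"
    \<comment> \<open>\<open>N\<close> stays fixed while \<open>K\<close> grows, so the hypothesis
      is needed at \<open>Suc M\<close>: \<open>K + Suc M\<close> equals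
      \<open>Suc K + M\<close>.\<close>
    using Suc.IH[of "Suc M"]
    unfolding pK qS add_Suc_right N_def[symmetric] b_def[symmetric] X_def[symmetric] Y_def[symmetric]
    .
  have K0: "of_nat (Suc K) \<noteq> (0::'a)" by (rule of_nat_neq_0)
  have diffs: "Suc N - Suc K = Suc M" "N - Suc K = M" by (simp_all add: N_def)
  have pS: "pochhammer (c + of_nat (Suc K)) (Suc M) = p * (c + of_nat (Suc K) + of_nat M)"
    by (simp add: p_def pochhammer_Suc)
  have NK: "of_nat N = (of_nat (Suc K) + of_nat M :: 'a)" by (simp add: N_def)
  have "(\<Sum>k\<le>Suc K. of_nat (Suc N choose k) * pochhammer x k * pochhammer y k
              * pochhammer (c + of_nat k) (Suc N - k) * pochhammer (c - x - y) (Suc N - k)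
            - (c - x + of_nat N) * (c - y + of_nat N) *
              (of_nat (N choose k) * pochhammer x k * pochhammer y k
              * pochhammer (c + of_nat k) (N - k) * pochhammer (c - x - y) (N - k)))
       = - of_nat (N choose Suc K) * (X * (x + of_nat (Suc K))) * (Y * (y + of_nat (Suc K))) * p * q"
    unfolding sum.atMost_Suc IH diffs bS b' pS qS
    unfolding X_def[symmetric] Y_def[symmetric] p_def[symmetric] q_def[symmetric] NK
    using K0 by (simp add: divide_simps del: of_nat_Suc) (simp add: algebra_simps)
  then show ?case
    by (simp add: N_def X_def Y_def p_def q_def pochhammer_Suc)
qed

text \<open>This is the classical 3F2 sum with upper parameters x, y, -N and lower parameters c, 1 +
  x + y - c - N, multiplied by (c)_N (c - x - y)_N. That clears all denominators and leaves an
  identity of polynomials in x, y, c. The telescoped recursion at \<open>M = 0\<close> gives the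
  induction step.\<close>

theorem pfaff_saalschuetz:
  fixes x y c :: "'a::field_char_0"
  shows "(\<Sum>k\<le>N. of_nat (N choose k) * pochhammer x k * pochhammer y k
              * pochhammer (c + of_nat k) (N - k) * pochhammer (c - x - y) (N - k))
         = pochhammer (c - x) N * pochhammer (c - y) N"
proof (induction N)
  case 0
  show ?case by simp
next
  case (Suc N)
  show ?case
    using pfaff_saalschuetz_telescope[of N 0 x y c] Suc.IH
    by (simp add: sum_subtractf pochhammer_Suc[of "c - _"] flip: sum_distrib_left)
       (simp add: algebra_simps)
qed

section \<open>Bailey's kernel sum\<close>

lemma pochhammer_minus_of_nat:
  "pochhammer (- of_nat (m + N)) m = ((-1) ^ m * fact (m + N) / fact N :: 'a::field_char_0)"
proof -
  have "fact (m + N) = (fact N * pochhammer (of_nat (Suc N)) m :: 'a)"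
    using pochhammer_product'[of "1::'a" N m]
    by (simp add: pochhammer_fact[symmetric] add.commute)
  moreover have "of_nat (m + N) - of_nat m + 1 = (of_nat (Suc N) :: 'a)"
    by simp
  ultimately show ?thesis
    using pochhammer_minus[of "of_nat (m + N) :: 'a" m] by (simp only:) simp
qed

text \<open>The last \<open>j\<close> of the \<open>j + r\<close> factors are read backwards, each
  with its sign changed.\<close>

lemma pochhammer_reflect:
  fixes v :: "'a::comm_ring_1"
  shows "pochhammer v (j + r) = (-1) ^ j * pochhammer (1 - v - of_nat (j + r)) j * pochhammer v r"
proof -
  have "pochhammer (1 - v - of_nat (j + r)) j = (-1) ^ j * pochhammer (v + of_nat r) j"
    using pochhammer_minus[of "v + of_nat (j + r) - 1" j] by (simp add: algebra_simps)
  then show ?thesis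
    using pochhammer_product'[of v r j] by (simp add: ac_simps flip: power_mult_distrib)
qed

text \<open>The shift j = m + i turns the sum into a balanced 3F2 with upper parameters C + m, D +
  m, m - n and lower parameters 1 + a + 2m, C + D - n - a + m, which Pfaff-Saalschuetz evaluates.
  Read from right to left, it expands the C, D, -n part of a well-poised term in the
  kernels.\<close>

lemma bailey_kernel:
  fixes a C D :: "'a::field_char_0"
  assumes a: "\<And>k. pochhammer (1 + a) k \<noteq> 0"
    and C: "\<And>k. pochhammer (1 + a - C) k \<noteq> 0" and D: "\<And>k. pochhammer (1 + a - D) k \<noteq> 0"
    and CD: "\<And>k. pochhammer (C + D - of_nat n - a) k \<noteq> 0"
    and mn: "m \<le> n"
  shows "pochhammer (1 + a) n * pochhammer (1 + a - C - D) n
           / (pochhammer (1 + a - C) n * pochhammer (1 + a - D) n) *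
         (\<Sum>j=m..n. pochhammer C j * pochhammer D j * pochhammer (- of_nat n) j
            / (pochhammer (C + D - of_nat n - a) j * (fact (j - m) * pochhammer (1 + a) (j + m))))
       = (-1) ^ m * pochhammer C m * pochhammer D m * pochhammer (- of_nat n) m
           / (pochhammer (1 + a - C) m * pochhammer (1 + a - D) m * pochhammer (1 + a + of_nat n) m)"
proof -
  define N where "N = n - m"
  have n: "n = m + N" using mn by (simp add: N_def)
  define c where "c = 1 + a + of_nat (2 * m)"
  define v where "v = 1 + a - C - D"
  define x where "x = C + of_nat m"
  define y where "y = D + of_nat m"
  have v: "c - x - y = v" by (simp add: c_def v_def x_def y_def)
  \<comment> \<open>\<open>Q\<close> collects all that does not depend on the summation
    index.\<close>
  define Q where "Q = fact n / fact N * pochhammer C m * pochhammer D m / pochhammer (1 + a) (n + m)"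
  \<comment> \<open>The factor \<open>pochhammer v n\<close> comes from the prefactor: by
    reflection, its quotient by \<open>pochhammer (C + D - of_nat n - a) j\<close> is
    \<open>pochhammer v (n - j)\<close> up to the sign (-1)^j, and that sign cancels against the one
    from \<open>pochhammer (- of_nat n) j\<close>.\<close>
  have summand: "pochhammer v n * (pochhammer C j * pochhammer D j * pochhammer (- of_nat n) j
            / (pochhammer (C + D - of_nat n - a) j * (fact (j - m) * pochhammer (1 + a) (j + m))))
     = Q * (of_nat (N choose i) * pochhammer x i * pochhammer y i
              * pochhammer (c + of_nat i) (N - i) * pochhammer (c - x - y) (N - i))"
    if j: "j = m + i" and i: "i \<le> N" for i j
  proof -
    define r where "r = N - i"
    have N: "N = i + r" using i by (simp add: r_def)
    have nr: "n = j + r" by (simp add: n j N)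
    define s where "s = ((-1) ^ j :: 'a)"
    have ss: "s * (s * z) = z" for z by (simp add: s_def flip: mult.assoc power_mult_distrib)
    have h1: "pochhammer v n = s * pochhammer (C + D - of_nat n - a) j * pochhammer v r"
      using pochhammer_reflect[of v j r] by (simp add: nr v_def s_def algebra_simps)
    have h2: "pochhammer (- of_nat n) j = s * fact n / fact r"
      unfolding nr s_def by (rule pochhammer_minus_of_nat)
    have h3: "pochhammer (1 + a) (n + m) = pochhammer (1 + a) (j + m) * pochhammer (c + of_nat i) r"
      using pochhammer_product'[of "1 + a" "j + m" r] by (simp add: nr c_def j algebra_simps)
    have h4: "pochhammer C j = pochhammer C m * pochhammer x i"
                  "pochhammer D j = pochhammer D m * pochhammer y i"
      by (simp_all add: j x_def y_def pochhammer_product')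
    have h5: "(of_nat (N choose i) :: 'a) = fact N / (fact i * fact r)"
      using binomial_fact[OF i] by (simp add: r_def)
    have h6: "j - m = i" by (simp add: j)
    have "pochhammer (c + of_nat i) r \<noteq> 0" using a[of "n + m"] by (auto simp: h3)
    then show ?thesis
      unfolding v Q_def r_def[symmetric] h1 h2 h3 h4 h5 h6
      using a[of "j + m"] CD[of j] by (simp add: field_simps ss)
  qed
  have "(\<Sum>j=m..n. pochhammer v n * (pochhammer C j * pochhammer D j * pochhammer (- of_nat n) j
            / (pochhammer (C + D - of_nat n - a) j * (fact (j - m) * pochhammer (1 + a) (j + m)))))
      = (\<Sum>i\<le>N. Q * (of_nat (N choose i) * pochhammer x i * pochhammer y i
              * pochhammer (c + of_nat i) (N - i) * pochhammer (c - x - y) (N - i)))"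
  proof (rule sum.reindex_bij_witness[of _ "\<lambda>i. m + i" "\<lambda>j. j - m"], goal_cases)
    case (5 j)
    then show ?case by (intro summand[symmetric]) (auto simp: n)
  qed (auto simp: n)
  also have "\<dots> = Q * (pochhammer (c - x) N * pochhammer (c - y) N)"
    unfolding sum_distrib_left[symmetric] pfaff_saalschuetz ..
  finally have S: "pochhammer v n * (\<Sum>j=m..n. pochhammer C j * pochhammer D j * pochhammer (- of_nat n) j
            / (pochhammer (C + D - of_nat n - a) j * (fact (j - m) * pochhammer (1 + a) (j + m))))
       = Q * (pochhammer (c - x) N * pochhammer (c - y) N)"
    by (simp add: sum_distrib_left)
  have Cn: "pochhammer (1 + a - C) n = pochhammer (1 + a - C) m * pochhammer (c - x) N"
   and Dn: "pochhammer (1 + a - D) n = pochhammer (1 + a - D) m * pochhammer (c - y) N"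
    using pochhammer_product'[of "1 + a - C" m N] pochhammer_product'[of "1 + a - D" m N]
    by (simp_all add: n c_def x_def y_def algebra_simps)
  have nz: "pochhammer (c - x) N \<noteq> 0" "pochhammer (c - y) N \<noteq> 0"
    using C[of n] D[of n] unfolding Cn Dn by auto
  have an: "pochhammer (1 + a) (n + m) = pochhammer (1 + a) n * pochhammer (1 + a + of_nat n) m"
    by (simp add: pochhammer_product')
  have an0: "pochhammer (1 + a + of_nat n) m \<noteq> 0"
    using a[of "n + m"] unfolding an by auto
  have nm: "pochhammer (- of_nat n) m = ((-1) ^ m * fact n / fact N :: 'a)"
    unfolding n by (rule pochhammer_minus_of_nat)
  \<comment> \<open>A rewrite rule that moves \<open>pochhammer v n\<close> next to the sum, so that
    \<open>S\<close> applies.\<close>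
  have "pochhammer (1 + a) n * v' / (P1 * P2) * s = pochhammer (1 + a) n / (P1 * P2) * (v' * s)"
    for v' P1 P2 s :: 'a by simp
  then show ?thesis
    unfolding v_def[symmetric]
    using nz an0 C[of m] D[of m] a[of n]
    by (simp only: S) (cases "even m"; simp add: Q_def Cn Dn an nm mult_ac)
qed

section \<open>A terminating very-well-poised 5F4\<close>

text \<open>The part of the left-hand terms free of C, D, E. The first quotient is the
  very-well-poised factor (1 + A/2)_k / (A/2)_k in closed form.\<close>

definition wp_coeff :: "'a::field_char_0 \<Rightarrow> 'a \<Rightarrow> nat \<Rightarrow> 'a" where
  "wp_coeff A B k = (A + 2 * of_nat k) / A * pochhammer A k * pochhammer B k
     / (pochhammer (1 + A - B) k * fact k)"

text \<open>By duplication, (-j)_{2k} stands for the upper pair -j/2, (1 - j)/2, and the denominator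
  for the matching lower pair; the powers of 4 cancel.\<close>

definition wp_term :: "'a::field_char_0 \<Rightarrow> 'a \<Rightarrow> nat \<Rightarrow> nat \<Rightarrow> 'a" where
  "wp_term A B j k = wp_coeff A B k
     * pochhammer (- of_nat j) (2 * k) / pochhammer (1 + 2 * A + of_nat j) (2 * k)"

lemma pochhammer_double_Suc:
  "pochhammer (z::'a::comm_ring_1) (2 * Suc K)
    = pochhammer z (Suc (2 * K)) * (z + 2 * of_nat K + 1)"
  by (simp add: pochhammer_Suc algebra_simps)

text \<open>The WZ recursion in \<open>j\<close>, again as a partial sum whose right-hand side is
  the certificate. It contains (-j)_{2K+1}, hence vanishes once 2K is at least
  \<open>j\<close>.\<close>

lemma wp_term_telescope:
  fixes A B :: "'a::field_char_0"
  assumes A: "A \<noteq> 0" and AB: "\<And>k. pochhammer (1 + A - B) k \<noteq> 0"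
    and A2: "\<And>k. pochhammer (1 + 2 * A) k \<noteq> 0"
  shows "(\<Sum>k\<le>K. (A + 1/2 + of_nat j) * (2 * A - 2 * B + 1 + of_nat j) * wp_term A B (Suc j) k
            - (1 + 2 * A + of_nat j) * (A - B + 1/2 + of_nat j) * wp_term A B j k)
       = pochhammer (A + 1) K * pochhammer B (Suc K) * pochhammer (- of_nat j) (Suc (2 * K))
           / (pochhammer (1 + A - B) K * fact K * pochhammer (2 + 2 * A + of_nat j) (2 * K))"
proof (induction K)
  case 0
  show ?case using A by (simp add: wp_term_def wp_coeff_def field_simps)
next
  case (Suc K)
  have nz: "1 + 2 * A + of_nat i \<noteq> 0" for i :: nat
    using A2[of "Suc i"] by (auto simp: pochhammer_Suc)
  define J where "J = (of_nat j :: 'a)"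
  define k where "k = (of_nat K :: 'a)"
  define P where "P = pochhammer (A + 1) K"
  define b where "b = pochhammer B (Suc K)"
  define M where "M = pochhammer (- J) (Suc (2 * K))"
  define W where "W = pochhammer (1 + A - B) K"
  define Z where "Z = pochhammer (2 + 2 * A + J) (2 * K)"
  have n1: "1 + 2 * A + J \<noteq> 0" using nz[of j] by (simp add: J_def)
  have n2: "2 + 2 * A + J + 2 * k \<noteq> 0"
    using nz[of "j + 2 * K + 1"] by (simp add: J_def k_def algebra_simps)
  have n3: "3 + 2 * A + J + 2 * k \<noteq> 0"
    using nz[of "j + 2 * K + 2"] by (simp add: J_def k_def algebra_simps)
  have W0: "W \<noteq> 0" "1 + A - B + k \<noteq> 0"
    using AB[of "Suc K"] by (auto simp: W_def k_def pochhammer_Suc)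
  have Z0: "Z \<noteq> 0"
    \<comment> \<open>\<open>Z\<close> is the tail of a longer Pochhammer symbol that starts at 1 +
      2A and is nonzero by \<open>A2\<close>.\<close>
    using A2[of "Suc j + 2 * K"] pochhammer_product'[of "1 + 2 * A" "Suc j" "2 * K"]
    by (auto simp: Z_def J_def algebra_simps)
  have k0: "k + 1 \<noteq> 0" using of_nat_neq_0[of K, where 'a='a] by (simp add: k_def add.commute)
  have fS: "fact (Suc K) = (k + 1) * (fact K :: 'a)" by (simp add: k_def add.commute)
  have WS: "pochhammer (1 + A - B) (Suc K) = W * (1 + A - B + k)"
    by (simp add: W_def k_def pochhammer_Suc)
  have AS: "(A + 2 * of_nat (Suc K)) / A * pochhammer A (Suc K) = (A + 2 * (k + 1)) * P"
    using A by (simp add: P_def k_def pochhammer_rec ac_simps)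
  have jS: "1 + 2 * A + of_nat (Suc j) = 2 + 2 * A + of_nat j" by simp
  have M1: "pochhammer (- of_nat (Suc j)) (2 * Suc K) = - (J + 1) * M"
  proof -
    have "2 * Suc K = Suc (Suc (2 * K))" "- of_nat (Suc j) + 1 = - J" by (simp_all add: J_def)
    then show ?thesis
      using pochhammer_rec[of "- of_nat (Suc j) :: 'a" "Suc (2 * K)"]
      by (simp only: M_def J_def) simp
  qed
  have M0: "pochhammer (- of_nat j) (2 * Suc K) = M * (2 * k + 1 - J)"
    unfolding pochhammer_double_Suc by (simp add: M_def J_def k_def algebra_simps)
  have M3: "pochhammer (- of_nat j) (Suc (2 * Suc K)) = M * (2 * k + 1 - J) * (2 * k + 2 - J)"
    unfolding pochhammer_Suc[of _ "2 * Suc K"] M0 by (simp add: J_def k_def algebra_simps)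
  have Z2: "pochhammer (2 + 2 * A + of_nat j) (2 * Suc K)
              = Z * (2 + 2 * A + J + 2 * k) * (3 + 2 * A + J + 2 * k)"
    unfolding pochhammer_double_Suc pochhammer_Suc by (simp add: Z_def J_def k_def algebra_simps)
  have Z1: "pochhammer (1 + 2 * A + of_nat j) (2 * Suc K)
              = (1 + 2 * A + J) * (Z * (2 + 2 * A + J + 2 * k))"
  proof -
    have "2 * Suc K = Suc (Suc (2 * K))" "1 + 2 * A + J + 1 = 2 + 2 * A + J" by simp_all
    then show ?thesis
      unfolding J_def[symmetric]
      by (simp only: pochhammer_rec[of "1 + 2 * A + J"] pochhammer_Suc[of "2 + 2 * A + J"])
         (simp add: Z_def k_def)
  qed
  have F1: "wp_term A B (Suc j) (Suc K) = (A + 2 * (k + 1)) * P * b / (W * (1 + A - B + k) * ((k + 1) * fact K))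
      * (- (J + 1) * M) / (Z * (2 + 2 * A + J + 2 * k) * (3 + 2 * A + J + 2 * k))"
    unfolding wp_term_def wp_coeff_def AS WS fS M1 jS Z2 b_def ..
  have F0: "wp_term A B j (Suc K) = (A + 2 * (k + 1)) * P * b / (W * (1 + A - B + k) * ((k + 1) * fact K))
      * (M * (2 * k + 1 - J)) / ((1 + 2 * A + J) * (Z * (2 + 2 * A + J + 2 * k)))"
    unfolding wp_term_def wp_coeff_def AS WS fS M0 Z1 b_def ..
  have PS': "pochhammer (A + 1) (Suc K) = P * (A + 1 + k)"
    by (simp add: P_def k_def pochhammer_Suc)
  have bS: "pochhammer B (Suc (Suc K)) = b * (B + k + 1)"
    by (simp add: b_def k_def pochhammer_Suc algebra_simps)
  \<comment> \<open>Certificate at \<open>K\<close> plus the new difference of terms equals the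
    certificate at \<open>Suc K\<close>.\<close>
  have key: "P * b * M / (W * fact K * Z) +
     ((A + 1/2 + J) * (2 * A - 2 * B + 1 + J) * ((A + 2 * (k + 1)) * P * b / (W * (1 + A - B + k) * ((k + 1) * fact K))
      * (- (J + 1) * M) / (Z * (2 + 2 * A + J + 2 * k) * (3 + 2 * A + J + 2 * k)))
     - (1 + 2 * A + J) * (A - B + 1/2 + J) * ((A + 2 * (k + 1)) * P * b / (W * (1 + A - B + k) * ((k + 1) * fact K))
      * (M * (2 * k + 1 - J)) / ((1 + 2 * A + J) * (Z * (2 + 2 * A + J + 2 * k)))))
    = P * (A + 1 + k) * (b * (B + k + 1)) * (M * (2 * k + 1 - J) * (2 * k + 2 - J))
      / (W * (1 + A - B + k) * ((k + 1) * fact K) * (Z * (2 + 2 * A + J + 2 * k) * (3 + 2 * A + J + 2 * k)))"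
    (is "?L = ?R")
  proof -
    \<comment> \<open>\<open>U\<close> is the common factor. Once it and the common denominator are
      split off, a polynomial identity of degree four in A, B, J, k remains.\<close>
    define U where "U = P * b * M / (W * fact K * Z)"
    define d1 where "d1 = 1 + A - B + k"
    define d2 where "d2 = 2 + 2 * A + J + 2 * k"
    define d3 where "d3 = 3 + 2 * A + J + 2 * k"
    define e where "e = k + 1"
    have d: "d1 \<noteq> 0" "d2 \<noteq> 0" "d3 \<noteq> 0" "e \<noteq> 0"
      using W0 n2 n3 k0 by (auto simp: d1_def d2_def d3_def e_def)
    have L: "?L = U * (d1 * e * d2 * d3
              - (A + 1/2 + J) * (2 * A - 2 * B + 1 + J) * (A + 2 * e) * (J + 1)
              - (A - B + 1/2 + J) * (A + 2 * e) * (2 * k + 1 - J) * d3) / (d1 * e * d2 * d3)"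
      unfolding U_def d1_def[symmetric] d2_def[symmetric] d3_def[symmetric] e_def[symmetric]
      using d n1 W0 Z0 by (simp add: divide_simps) (simp add: algebra_simps)
    have R: "?R = U * ((A + 1 + k) * (B + k + 1) * (2 * k + 1 - J) * (2 * k + 2 - J)) / (d1 * e * d2 * d3)"
      unfolding U_def d1_def[symmetric] d2_def[symmetric] d3_def[symmetric] e_def[symmetric]
      using d W0 Z0 by (simp add: divide_simps)
    have "d1 * e * d2 * d3
              - (A + 1/2 + J) * (2 * A - 2 * B + 1 + J) * (A + 2 * e) * (J + 1)
              - (A - B + 1/2 + J) * (A + 2 * e) * (2 * k + 1 - J) * d3
          = (A + 1 + k) * (B + k + 1) * (2 * k + 1 - J) * (2 * k + 2 - J)"
      unfolding d1_def d2_def d3_def e_def by (simp add: field_simps)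
    then show ?thesis unfolding L R by simp
  qed
  show ?case
    unfolding sum.atMost_Suc Suc.IH F1 F0 WS PS' bS M3 Z2 fS
    unfolding P_def[symmetric] W_def[symmetric] b_def[symmetric] J_def[symmetric]
      M_def[symmetric] Z_def[symmetric]
    by (rule key)
qed

text \<open>Induction on \<open>j\<close> by the recursion. The bound \<open>K\<close> is fixed, so
  that the sums for \<open>j\<close> and \<open>Suc j\<close> have the same range; terms with 2k > j
  vanish anyway.\<close>

lemma wp_term_sum:
  fixes A B :: "'a::field_char_0"
  assumes A: "A \<noteq> 0" and AB: "\<And>k. pochhammer (1 + A - B) k \<noteq> 0"
    and A2: "\<And>k. pochhammer (1 + 2 * A) k \<noteq> 0"
    and Ah: "\<And>k. pochhammer (A + 1/2) k \<noteq> 0"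
    and AB2: "\<And>k. pochhammer (2 * A - 2 * B + 1) k \<noteq> 0"
    and "j \<le> K"
  shows "(\<Sum>k\<le>K. wp_term A B j k) = pochhammer (1 + 2 * A) j * pochhammer (A - B + 1/2) j
           / (pochhammer (A + 1/2) j * pochhammer (2 * A - 2 * B + 1) j)"
  using \<open>j \<le> K\<close>
proof (induction j)
  case 0
  have "(\<Sum>k\<le>K. wp_term A B 0 k) = (\<Sum>k\<in>{0}. wp_term A B 0 k)"
    by (rule sum.mono_neutral_right) (auto simp: wp_term_def pochhammer_0_left)
  then show ?case using A by (simp add: wp_term_def wp_coeff_def)
next
  case (Suc j)
  \<comment> \<open>\<open>q / p\<close> is the ratio of consecutive closed forms.\<close>
  define p where "p = (A + 1/2 + of_nat j) * (2 * A - 2 * B + 1 + of_nat j)"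
  define q where "q = (1 + 2 * A + of_nat j) * (A - B + 1/2 + of_nat j)"
  have p0: "p \<noteq> 0"
    using Ah[of "Suc j"] AB2[of "Suc j"] by (auto simp: p_def pochhammer_Suc)
  have "pochhammer (- of_nat j) (Suc (2 * K)) = (0::'a)"
    using Suc.prems by (intro pochhammer_of_nat_eq_0_lemma) simp
  hence "(\<Sum>k\<le>K. p * wp_term A B (Suc j) k - q * wp_term A B j k) = 0"
    unfolding p_def q_def by (simp only: wp_term_telescope[OF A AB A2]) simp
  hence "p * (\<Sum>k\<le>K. wp_term A B (Suc j) k) = q * (\<Sum>k\<le>K. wp_term A B j k)"
    by (simp add: sum_subtractf sum_distrib_left)
  also have "(\<Sum>k\<le>K. wp_term A B j k) = pochhammer (1 + 2 * A) j * pochhammer (A - B + 1/2) j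
           / (pochhammer (A + 1/2) j * pochhammer (2 * A - 2 * B + 1) j)"
    using Suc by simp
  finally have "(\<Sum>k\<le>K. wp_term A B (Suc j) k) = q / p * (pochhammer (1 + 2 * A) j * pochhammer (A - B + 1/2) j
           / (pochhammer (A + 1/2) j * pochhammer (2 * A - 2 * B + 1) j))"
    using p0 by (metis nonzero_mult_div_cancel_left times_divide_eq_left)
  then show ?case
    by (simp add: p_def q_def pochhammer_Suc mult_ac)
qed


section \<open>The Bailey pair and the finite transformation\<close>

lemma pochhammer_nonpos_of_nat_even:
  "pochhammer (- of_nat j) (2 * k) = (if 2 * k \<le> j then fact j / fact (j - 2 * k) else 0 :: 'a::field_char_0)"
proof (cases "2 * k \<le> j")
  case True
  then show ?thesis
    using pochhammer_minus_of_nat[of "2 * k" "j - 2 * k", where 'a='a] by simp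
qed (simp add: pochhammer_of_nat_eq_0_lemma)

text \<open>The 5F4 sum divided by j! (1 + 2A)_j, which turns each term into \<open>wp_coeff\<close>
  times a kernel. In Bailey's language, alpha is \<open>wp_coeff A B k\<close> at index 2k and zero
  at odd indices, and the right-hand side is beta.\<close>

lemma wp_coeff_bailey_pair:
  fixes A B :: "'a::field_char_0"
  assumes A: "A \<noteq> 0" and AB: "\<And>k. pochhammer (1 + A - B) k \<noteq> 0"
    and A2: "\<And>k. pochhammer (1 + 2 * A) k \<noteq> 0"
    and Ah: "\<And>k. pochhammer (A + 1/2) k \<noteq> 0"
    and AB2: "\<And>k. pochhammer (2 * A - 2 * B + 1) k \<noteq> 0"
    and jK: "j \<le> K"
  shows "(\<Sum>k | k \<le> K \<and> 2 * k \<le> j. wp_coeff A B k / (fact (j - 2 * k) * pochhammer (1 + 2 * A) (j + 2 * k)))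
       = pochhammer (A - B + 1/2) j
           / (pochhammer (A + 1/2) j * pochhammer (2 * A - 2 * B + 1) j * fact j)"
proof -
  have "(\<Sum>k | k \<le> K \<and> 2 * k \<le> j. wp_coeff A B k / (fact (j - 2 * k) * pochhammer (1 + 2 * A) (j + 2 * k)))
      = (\<Sum>k\<le>K. wp_term A B j k / (fact j * pochhammer (1 + 2 * A) j))"
  proof (rule sum.mono_neutral_cong_left)
    fix k assume "k \<in> {k. k \<le> K \<and> 2 * k \<le> j}"
    then have e: "pochhammer (- of_nat j) (2 * k) = (fact j / fact (j - 2 * k) :: 'a)"
      by (simp add: pochhammer_nonpos_of_nat_even)
    show "wp_coeff A B k / (fact (j - 2 * k) * pochhammer (1 + 2 * A) (j + 2 * k))
        = wp_term A B j k / (fact j * pochhammer (1 + 2 * A) j)"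
      unfolding wp_term_def e pochhammer_product' by (simp add: mult_ac)
  qed (auto simp: wp_term_def pochhammer_nonpos_of_nat_even)
  also have "\<dots> = (\<Sum>k\<le>K. wp_term A B j k) / (fact j * pochhammer (1 + 2 * A) j)"
    by (simp add: sum_divide_distrib)
  also have "\<dots> = pochhammer (A - B + 1/2) j
           / (pochhammer (A + 1/2) j * pochhammer (2 * A - 2 * B + 1) j * fact j)"
    using A2[of j] by (simp add: wp_term_sum[OF A AB A2 Ah AB2 jK])
  finally show ?thesis .
qed

text \<open>The case E = -n: expand each left-hand term by \<open>bailey_kernel\<close> with a = 2A
  and m = 2k, exchange the sums, and evaluate the inner sum by the Bailey pair.\<close>

lemma wp_quadratic_transformation:
  fixes A B C D :: "'a::field_char_0"
  assumes A: "A \<noteq> 0" and AB: "\<And>k. pochhammer (1 + A - B) k \<noteq> 0"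
    and A2: "\<And>k. pochhammer (1 + 2 * A) k \<noteq> 0"
    and Ah: "\<And>k. pochhammer (A + 1/2) k \<noteq> 0"
    and AB2: "\<And>k. pochhammer (2 * A - 2 * B + 1) k \<noteq> 0"
    and C: "\<And>k. pochhammer (1 + 2 * A - C) k \<noteq> 0" and D: "\<And>k. pochhammer (1 + 2 * A - D) k \<noteq> 0"
    and CD: "\<And>k. pochhammer (C + D - of_nat n - 2 * A) k \<noteq> 0"
  shows "(\<Sum>k\<le>n. wp_coeff A B k
            * (pochhammer C (2 * k) * pochhammer D (2 * k) * pochhammer (- of_nat n) (2 * k))
            / (pochhammer (1 + 2 * A - C) (2 * k) * pochhammer (1 + 2 * A - D) (2 * k)
               * pochhammer (1 + 2 * A + of_nat n) (2 * k)))
       = pochhammer (1 + 2 * A) n * pochhammer (1 + 2 * A - C - D) n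
           / (pochhammer (1 + 2 * A - C) n * pochhammer (1 + 2 * A - D) n) *
         (\<Sum>j\<le>n. pochhammer (A - B + 1/2) j * pochhammer C j * pochhammer D j * pochhammer (- of_nat n) j
            / (pochhammer (A + 1/2) j * pochhammer (2 * A - 2 * B + 1) j
               * pochhammer (C + D - of_nat n - 2 * A) j * fact j))"
    (is "(\<Sum>k\<le>n. ?l k) = ?Q * (\<Sum>j\<le>n. ?r j)")
proof -
  define w where "w j = pochhammer C j * pochhammer D j * pochhammer (- of_nat n) j
            / pochhammer (C + D - of_nat n - 2 * A) j" for j
  define f where "f k j = w j * (wp_coeff A B k / (fact (j - 2 * k) * pochhammer (1 + 2 * A) (j + 2 * k)))"
    for k j
  have l: "?l k = ?Q * (\<Sum>j | j \<in> {..n} \<and> 2 * k \<le> j. f k j)" for k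
  proof (cases "2 * k \<le> n")
    case True
    have "{j. j \<in> {..n} \<and> 2 * k \<le> j} = {2 * k..n}" by auto
    moreover have "?Q * (\<Sum>j=2*k..n. f k j) = wp_coeff A B k * (?Q * (\<Sum>j=2*k..n.
        pochhammer C j * pochhammer D j * pochhammer (- of_nat n) j
            / (pochhammer (C + D - of_nat n - 2 * A) j * (fact (j - 2 * k) * pochhammer (1 + 2 * A) (j + 2 * k)))))"
      unfolding sum_distrib_left by (intro sum.cong refl) (simp add: f_def w_def)
    ultimately show ?thesis
      unfolding bailey_kernel[OF A2 C D CD True] by simp
  next
    \<comment> \<open>Here (-n)_{2k} = 0 on the left and the index set on the right is
      empty.\<close>
    case False
    then have "{j. j \<in> {..n} \<and> 2 * k \<le> j} = {}" by auto
    then show ?thesis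
      using False by (simp only: sum.empty pochhammer_nonpos_of_nat_even if_False) simp
  qed
  have r: "(\<Sum>k | k \<in> {..n} \<and> 2 * k \<le> j. f k j) = ?r j" if "j \<le> n" for j
    using wp_coeff_bailey_pair[OF A AB A2 Ah AB2 that]
    unfolding f_def sum_distrib_left[symmetric] by (simp add: w_def mult_ac)
  have "(\<Sum>k\<le>n. ?l k) = ?Q * (\<Sum>k\<le>n. \<Sum>j | j \<in> {..n} \<and> 2 * k \<le> j. f k j)"
    unfolding l sum_distrib_left ..
  also have "(\<Sum>k\<le>n. \<Sum>j | j \<in> {..n} \<and> 2 * k \<le> j. f k j) = (\<Sum>j\<le>n. \<Sum>k | k \<in> {..n} \<and> 2 * k \<le> j. f k j)"
    by (rule sum.swap_restrict) auto
  also have "\<dots> = (\<Sum>j\<le>n. ?r j)"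
    by (intro sum.cong refl r) simp
  finally show ?thesis .
qed

section \<open>Complex series, Gamma factors and symmetry\<close>

lemma pochhammer_nonzero:
  fixes z :: complex
  shows "z \<notin> \<int>\<^sub>\<le>\<^sub>0 \<Longrightarrow> pochhammer z n \<noteq> 0"
  using pochhammer_eq_0_imp_nonpos_Int by blast

lemma pochhammer_Delta2:
  "pochhammer (z / 2) k * pochhammer ((z + 1) / 2) k = pochhammer z (2 * k) / (4::complex) ^ k"
  using pochhammer_double[of "z / 2" k] by (simp add: add_divide_distrib power_mult)

text \<open>Each Delta pair is merged into one Pochhammer symbol of length 2k; with three pairs
  above and three below, the powers of 4 cancel.\<close>

definition lhs_term where
  "lhs_term A B C D E k = wp_coeff A B k
     * (pochhammer C (2 * k) * pochhammer D (2 * k) * pochhammer E (2 * k))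
     / (pochhammer (1 + 2 * A - C) (2 * k) * pochhammer (1 + 2 * A - D) (2 * k)
        * pochhammer (1 + 2 * A - E) (2 * k))"

definition rhs_term where
  "rhs_term A B C D E j = pochhammer (A - B + 1/2) j * pochhammer C j * pochhammer D j * pochhammer E j
     / (pochhammer (A + 1/2) j * pochhammer (2 * A - 2 * B + 1) j
        * pochhammer (C + D + E - 2 * A) j * fact j)"

lemma hyp_terms_lhs:
  assumes "A \<noteq> 0" "pochhammer (A / 2) k \<noteq> 0"
  shows "hyp_terms ([A, 1 + A/2, B] @ Delta2 C @ Delta2 D @ Delta2 E)
     ([A/2, 1 + A - B] @ Delta2 (1 + 2*A - C) @ Delta2 (1 + 2*A - D) @ Delta2 (1 + 2*A - E)) k
     = lhs_term A B C D E k"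
proof -
  \<comment> \<open>Both sides are (A/2)_{k+1}, with the first or the last factor split off.\<close>
  have "A / 2 * pochhammer (1 + A / 2) k = pochhammer (A / 2) k * (A / 2 + of_nat k)"
    using pochhammer_rec[of "A / 2" k] pochhammer_Suc[of "A / 2" k] by (simp add: add.commute)
  then have r: "pochhammer (1 + A / 2) k = pochhammer (A / 2) k * ((A + 2 * of_nat k) / A)"
    using assms(1) by (simp add: field_simps)
  have "hyp_terms ([A, 1 + A/2, B] @ Delta2 C @ Delta2 D @ Delta2 E)
     ([A/2, 1 + A - B] @ Delta2 (1 + 2*A - C) @ Delta2 (1 + 2*A - D) @ Delta2 (1 + 2*A - E)) k
    = pochhammer A k * pochhammer (1 + A / 2) k * pochhammer B k
      * (pochhammer (C / 2) k * pochhammer ((C + 1) / 2) k)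
      * (pochhammer (D / 2) k * pochhammer ((D + 1) / 2) k)
      * (pochhammer (E / 2) k * pochhammer ((E + 1) / 2) k)
      / (pochhammer (A / 2) k * pochhammer (1 + A - B) k
      * (pochhammer ((1 + 2*A - C) / 2) k * pochhammer (((1 + 2*A - C) + 1) / 2) k)
      * (pochhammer ((1 + 2*A - D) / 2) k * pochhammer (((1 + 2*A - D) + 1) / 2) k)
      * (pochhammer ((1 + 2*A - E) / 2) k * pochhammer (((1 + 2*A - E) + 1) / 2) k) * fact k)"
    by (simp add: hyp_terms_def Delta2_def mult_ac)
  also have "\<dots> = lhs_term A B C D E k"
    unfolding pochhammer_Delta2 r lhs_term_def wp_coeff_def
    using assms(2) by (simp add: mult_ac)
  finally show ?thesis .
qed

lemma hyp_terms_rhs: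
  "hyp_terms [A - B + 1/2, C, D, E] [A + 1/2, 2*A - 2*B + 1, C + D + E - 2*A] k = rhs_term A B C D E k"
  by (simp add: hyp_terms_def rhs_term_def)

definition gamma_factor :: "complex \<Rightarrow> complex \<Rightarrow> complex \<Rightarrow> complex \<Rightarrow> complex" where
  "gamma_factor A C D E =
     (Gamma (1 + 2*A - C) * Gamma (1 + 2*A - D) * Gamma (1 + 2*A - E) * Gamma (1 + 2*A - C - D - E)) /
     (Gamma (1 + 2*A) * Gamma (1 + 2*A - C - D) * Gamma (1 + 2*A - C - E) * Gamma (1 + 2*A - D - E))"

lemma gamma_factor_nonpos_Int:
  assumes "1 + 2*A \<notin> \<int>\<^sub>\<le>\<^sub>0" "1 + 2*A - C \<notin> \<int>\<^sub>\<le>\<^sub>0" "1 + 2*A - D \<notin> \<int>\<^sub>\<le>\<^sub>0" "1 + 2*A - C - D \<notin> \<int>\<^sub>\<le>\<^sub>0"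
  shows "gamma_factor A C D (- of_nat n)
    = pochhammer (1 + 2 * A) n * pochhammer (1 + 2 * A - C - D) n
           / (pochhammer (1 + 2 * A - C) n * pochhammer (1 + 2 * A - D) n)"
proof -
  \<comment> \<open>The double minus is kept to match \<open>gamma_factor_def\<close> at E = -n
    literally.\<close>
  have "Gamma (z - - of_nat n) = Gamma z * pochhammer z n" if "z \<notin> \<int>\<^sub>\<le>\<^sub>0" for z :: complex
    using that pochhammer_Gamma[OF that, of n] Gamma_eq_zero_iff[of z] by simp
  from this[OF assms(1)] this[OF assms(2)] this[OF assms(3)] this[OF assms(4)]
  show ?thesis
    using assms unfolding gamma_factor_def by (simp only:) (simp add: Gamma_eq_zero_iff)
qed

lemma terminating_identity:
  fixes A B C D E :: complex
  assumes E: "E \<in> \<int>\<^sub>\<le>\<^sub>0" and A: "A \<noteq> 0"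
    and low: "1 + A - B \<notin> \<int>\<^sub>\<le>\<^sub>0" "A + 1/2 \<notin> \<int>\<^sub>\<le>\<^sub>0" "2 * A - 2 * B + 1 \<notin> \<int>\<^sub>\<le>\<^sub>0"
      "C + D + E - 2 * A \<notin> \<int>\<^sub>\<le>\<^sub>0"
    and gam: "1 + 2*A \<notin> \<int>\<^sub>\<le>\<^sub>0" "1 + 2*A - C \<notin> \<int>\<^sub>\<le>\<^sub>0" "1 + 2*A - D \<notin> \<int>\<^sub>\<le>\<^sub>0" "1 + 2*A - C - D \<notin> \<int>\<^sub>\<le>\<^sub>0"
  shows "(\<Sum>k. lhs_term A B C D E k) = gamma_factor A C D E * (\<Sum>k. rhs_term A B C D E k)"
proof -
  obtain n where n: "E = - of_nat n" using E by (elim nonpos_Ints_cases')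
  have "(\<Sum>k. lhs_term A B C D E k) = (\<Sum>k\<le>n. lhs_term A B C D E k)"
    by (rule suminf_finite) (auto simp: lhs_term_def n pochhammer_of_nat_eq_0_lemma)
  moreover have "(\<Sum>k. rhs_term A B C D E k) = (\<Sum>k\<le>n. rhs_term A B C D E k)"
    by (rule suminf_finite) (auto simp: rhs_term_def n pochhammer_of_nat_eq_0_lemma)
  moreover have "pochhammer (C + D - of_nat n - 2 * A) k \<noteq> 0" for k
    using pochhammer_nonzero[OF low(4)] by (simp add: n)
  note wp_quadratic_transformation[OF A low(1)[THEN pochhammer_nonzero] gam(1)[THEN pochhammer_nonzero]
    low(2,3)[THEN pochhammer_nonzero] gam(2,3)[THEN pochhammer_nonzero] this]
  ultimately show ?thesis
    unfolding n gamma_factor_nonpos_Int[OF gam] lhs_term_def rhs_term_def by simp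
qed

lemma terminating_identity_symmetric:
  fixes A B C D E :: complex
  assumes CDE: "C \<in> \<int>\<^sub>\<le>\<^sub>0 \<or> D \<in> \<int>\<^sub>\<le>\<^sub>0 \<or> E \<in> \<int>\<^sub>\<le>\<^sub>0" and A: "A \<noteq> 0"
    and low: "1 + A - B \<notin> \<int>\<^sub>\<le>\<^sub>0" "A + 1/2 \<notin> \<int>\<^sub>\<le>\<^sub>0" "2 * A - 2 * B + 1 \<notin> \<int>\<^sub>\<le>\<^sub>0"
      "C + D + E - 2 * A \<notin> \<int>\<^sub>\<le>\<^sub>0"
    and gam: "1 + 2*A \<notin> \<int>\<^sub>\<le>\<^sub>0"
      "1 + 2*A - C \<notin> \<int>\<^sub>\<le>\<^sub>0" "1 + 2*A - D \<notin> \<int>\<^sub>\<le>\<^sub>0" "1 + 2*A - E \<notin> \<int>\<^sub>\<le>\<^sub>0"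
      "1 + 2*A - C - D \<notin> \<int>\<^sub>\<le>\<^sub>0" "1 + 2*A - C - E \<notin> \<int>\<^sub>\<le>\<^sub>0" "1 + 2*A - D - E \<notin> \<int>\<^sub>\<le>\<^sub>0"
  shows "(\<Sum>k. lhs_term A B C D E k) = gamma_factor A C D E * (\<Sum>k. rhs_term A B C D E k)"
proof -
  \<comment> \<open>These permutations move the terminating parameter into the place of
    \<open>E\<close>.\<close>
  have perm: "lhs_term A B C E D = lhs_term A B C D E" "lhs_term A B D E C = lhs_term A B C D E"
    "rhs_term A B C E D = rhs_term A B C D E" "rhs_term A B D E C = rhs_term A B C D E"
    "gamma_factor A C E D = gamma_factor A C D E" "gamma_factor A D E C = gamma_factor A C D E"
    by (simp_all add: fun_eq_iff lhs_term_def rhs_term_def gamma_factor_def add_ac mult_ac diff_diff_add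
        diff_add_eq)
  have low': "C + E + D - 2 * A \<notin> \<int>\<^sub>\<le>\<^sub>0" "D + E + C - 2 * A \<notin> \<int>\<^sub>\<le>\<^sub>0"
    using low(4) by (simp_all add: add_ac)
  from CDE show ?thesis
  proof (elim disjE)
    assume "E \<in> \<int>\<^sub>\<le>\<^sub>0"
    from terminating_identity[OF this A low gam(1,2,3,5)] show ?thesis .
  next
    assume "D \<in> \<int>\<^sub>\<le>\<^sub>0"
    from terminating_identity[OF this A low(1-3) low'(1) gam(1,2,4,6)] show ?thesis
      unfolding perm .
  next
    assume "C \<in> \<int>\<^sub>\<le>\<^sub>0"
    from terminating_identity[OF this A low(1-3) low'(2) gam(1,3,4,7)] show ?thesis
      unfolding perm .
  qed
qed

text \<open>If A - B + 1/2 = -n, then the lower parameter 2A - 2B + 1 is its double, -2n.\<close>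

lemma rhs_terminatesD:
  assumes "hyp_terminates [A - B + 1/2, C, D, E]" "2 * A - 2 * B + 1 \<notin> \<int>\<^sub>\<le>\<^sub>0"
  shows "C \<in> \<int>\<^sub>\<le>\<^sub>0 \<or> D \<in> \<int>\<^sub>\<le>\<^sub>0 \<or> E \<in> \<int>\<^sub>\<le>\<^sub>0"
proof -
  have "A - B + 1/2 \<notin> \<int>\<^sub>\<le>\<^sub>0"
  proof
    assume "A - B + 1/2 \<in> \<int>\<^sub>\<le>\<^sub>0"
    then obtain n where "A - B + 1/2 = - of_nat n" by (elim nonpos_Ints_cases')
    then have "2 * A - 2 * B + 1 = - of_nat (2 * n)" by (simp add: field_simps)
    then show False using assms(2) by (metis minus_of_nat_in_nonpos_Ints)
  qed
  with assms(1) show ?thesis by (auto simp: hyp_terminates_def)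
qed

theorem mainTheorem13:
  fixes A B C D E :: complex
  defines "upL \<equiv> [A, 1 + A/2, B] @ Delta2 C @ Delta2 D @ Delta2 E"
    and "lowL \<equiv> [A/2, 1 + A - B] @ Delta2 (1 + 2*A - C) @ Delta2 (1 + 2*A - D) @ Delta2 (1 + 2*A - E)"
    and "upR \<equiv> [A - B + 1/2, C, D, E]"
    and "lowR \<equiv> [A + 1/2, 2*A - 2*B + 1, C + D + E - 2*A]"
    and "rhs_factor \<equiv>
        (Gamma (1 + 2*A - C) * Gamma (1 + 2*A - D) * Gamma (1 + 2*A - E) * Gamma (1 + 2*A - C - D - E)) /
        (Gamma (1 + 2*A) * Gamma (1 + 2*A - C - D) * Gamma (1 + 2*A - C - E) * Gamma (1 + 2*A - D - E))"
  assumes lower_ok: "hyp_lower_ok lowL" "hyp_lower_ok lowR"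
    and Gamma_ok: "\<forall>z \<in> {1 + 2*A - C, 1 + 2*A - D, 1 + 2*A - E, 1 + 2*A - C - D - E,
        1 + 2*A, 1 + 2*A - C - D, 1 + 2*A - C - E, 1 + 2*A - D - E}. z \<notin> \<int>\<^sub>\<le>\<^sub>0"
  shows "((\<exists>k::int. k < 0 \<and> E = of_int k) \<longrightarrow>
             hyp_at_1 upL lowL = rhs_factor * hyp_at_1 upR lowR) \<and>
         (hyp_converges upL lowL \<and> hyp_terminates upR \<longrightarrow>
             hyp_at_1 upL lowL = rhs_factor * hyp_at_1 upR lowR)"
proof -
  have low: "A / 2 \<notin> \<int>\<^sub>\<le>\<^sub>0" "1 + A - B \<notin> \<int>\<^sub>\<le>\<^sub>0" "A + 1/2 \<notin> \<int>\<^sub>\<le>\<^sub>0" "2 * A - 2 * B + 1 \<notin> \<int>\<^sub>\<le>\<^sub>0"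
      "C + D + E - 2 * A \<notin> \<int>\<^sub>\<le>\<^sub>0"
    using lower_ok by (simp_all add: lowL_def lowR_def hyp_lower_ok_def)
  have A: "A \<noteq> 0" using low(1) by auto
  have L: "hyp_at_1 upL lowL = (\<Sum>k. lhs_term A B C D E k)"
    unfolding hyp_at_1_def upL_def lowL_def
    by (intro arg_cong[of _ _ suminf] ext hyp_terms_lhs A pochhammer_nonzero low)
  have R: "hyp_at_1 upR lowR = (\<Sum>k. rhs_term A B C D E k)"
    unfolding hyp_at_1_def upR_def lowR_def
    by (intro arg_cong[of _ _ suminf] ext hyp_terms_rhs)
  \<comment> \<open>Both claims reduce to this: a negative integer \<open>E\<close> satisfies the
    last disjunct, and termination on the right gives one of the three.\<close>
  have main: "hyp_at_1 upL lowL = rhs_factor * hyp_at_1 upR lowR"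
    if "C \<in> \<int>\<^sub>\<le>\<^sub>0 \<or> D \<in> \<int>\<^sub>\<le>\<^sub>0 \<or> E \<in> \<int>\<^sub>\<le>\<^sub>0"
    using terminating_identity_symmetric[OF that A low(2-5)] Gamma_ok
    unfolding L R rhs_factor_def gamma_factor_def by simp
  have "E \<in> \<int>\<^sub>\<le>\<^sub>0" if "\<exists>k::int. k < 0 \<and> E = of_int k"
    using that by (auto intro!: nonpos_Ints_of_int)
  then show ?thesis
    using main rhs_terminatesD low(4) unfolding upR_def by blast
qed

end
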